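(* Let $k\ge 0$ be an integer and let $S_k=\{1,2,\ldots,k\}$ (with $S_0=\emptyset$). For every positive integer $n$ with $n\ge k+4$ or $n=k+2$, $$red^{S_k}(n) > rod^{S_k}(n)\ \text{ if } k \text{ is even},\qquad rod^{S_k}(n) > red^{S_k}(n)\ \text{ if } k \text{ is odd}.$$ For all other positive integers $n$ (that is, $n\le k+1$ or $n=k+3$), $red^{S_k}(n)=rod^{S_k}(n)$.
   Context: A partition is a finite, nonempty, nonincreasing sequence of positive integers called its parts. The perimeter of a partition $\pi$ is $\alpha_\pi+\lambda_\pi-1$, where $\alpha_\pi$ is the largest part of $\pi$ and $\lambda_\pi$ is the number of parts of $\pi$ (counted with multiplicity). For a set $S$ of positive integers, $red^S(n)$ is the number of partitions of perimeter $n$ with no parts from $S$ in which the even parts are distinct (no even part is repeated; odd parts are unrestricted), and $rod^S(n)$ is the number of partitions of perimeter $n$ with no parts from $S$ in which the odd parts are distinct (no odd part is repeated; even parts are unrestricted). *)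

theory Defs
  imports Main
begin

definition is_partition :: "nat list \<Rightarrow> bool" where
  "is_partition p \<longleftrightarrow> p \<noteq> [] \<and> sorted_wrt (\<ge>) p \<and> (\<forall>x\<in>set p. 0 < x)"

(* For a partition the truncated subtraction is harmless: the list is nonempty. *)
definition perimeter :: "nat list \<Rightarrow> nat" where
  "perimeter p = Max (set p) + length p - 1"

definition red_set :: "nat set \<Rightarrow> nat \<Rightarrow> nat list set" where
  "red_set S n = {p. is_partition p \<and> perimeter p = n \<and> set p \<inter> S = {} \<and>
     (\<forall>x\<in>set p. even x \<longrightarrow> count_list p x = 1)}"

definition rod_set :: "nat set \<Rightarrow> nat \<Rightarrow> nat list set" where
  "rod_set S n = {p. is_partition p \<and> perimeter p = n \<and> set p \<inter> S = {} \<and>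
     (\<forall>x\<in>set p. odd x \<longrightarrow> count_list p x = 1)}"

definition red :: "nat set \<Rightarrow> nat \<Rightarrow> nat" where
  "red S n = card (red_set S n)"

definition rod :: "nat set \<Rightarrow> nat \<Rightarrow> nat" where
  "rod S n = card (rod_set S n)"

(* The sets counted by red and rod are finite, so card is the true number of elements. *)
lemma finite_partitions_perimeter: "finite {p. is_partition p \<and> perimeter p = n}"
proof (rule finite_subset)
  show "finite {p. set p \<subseteq> {..n} \<and> length p \<le> n}"
    by (rule finite_lists_length_le) simp
  show "{p. is_partition p \<and> perimeter p = n} \<subseteq> {p. set p \<subseteq> {..n} \<and> length p \<le> n}"
  proof (rule subsetI, clarsimp simp only: mem_Collect_eq)
    fix p assume p: "is_partition p"
    have ne: "p \<noteq> []" and pos: "\<forall>x\<in>set p. 0 < x"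
      using p by (simp_all add: is_partition_def)
    have "Max (set p) \<in> set p" using ne by (intro Max_in) auto
    with pos have M: "0 < Max (set p)" by blast
    have L: "0 < length p" using ne by simp
    have "x \<le> Max (set p) + length p - 1" if "x \<in> set p" for x
    proof -
      have "x \<le> Max (set p)" using that by simp
      with L show ?thesis by linarith
    qed
    moreover have "length p \<le> Max (set p) + length p - 1" using M by linarith
    ultimately show "set p \<subseteq> {..perimeter p} \<and> length p \<le> perimeter p"
      unfolding perimeter_def by blast
  qed
qed

lemma finite_red_set: "finite (red_set S n)"
  by (rule finite_subset[OF _ finite_partitions_perimeter[of n]]) (auto simp: red_set_def)

lemma finite_rod_set: "finite (rod_set S n)"
  by (rule finite_subset[OF _ finite_partitions_perimeter[of n]]) (auto simp: rod_set_def)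

end

theory Submission
  imports Defs
begin

text \<open>Only the position of a part relative to \<open>k\<close> matters: lowering every part by one lowers the
  perimeter by one, forbids one number less, and exchanges the two parities
  (\<open>num_distinct_shift\<close>). After \<open>k\<close> such steps the comparison is between \<open>A m\<close> and \<open>B m\<close> with
  \<open>m = n - k\<close>, the numbers of
  partitions of perimeter \<open>m\<close> whose even (for \<open>A\<close>), respectively odd
  (for \<open>B\<close>), parts are distinct; they stand for \<open>red\<close> and \<open>rod\<close> in this order when \<open>k\<close> is even and
  in the opposite order when \<open>k\<close> is odd. This is the source of the alternation in the theorem.

  Removing one part equal to 1, if there is one, lowers the perimeter by one
  (\<open>distinct_partitions_peel\<close>); further parts 1 may then remain for \<open>A\<close> but not for \<open>B\<close>. Partitions
  without a part 1 are shifted, which exchanges \<open>A\<close> and \<open>B\<close>. This gives, up to the singleton partition \<open>[1]\<close>,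
  \<open>A (m + 1) = A m + B m\<close> and \<open>B (m + 1) = A m + A (m - 1)\<close>, whence
  \<open>A (m + 3) - B (m + 3) = B (m + 2) - A (m + 1) = A m\<close>. So the excess of \<open>A\<close> over \<open>B\<close> is itself a value of
  \<open>A\<close>; it vanishes at \<open>m = 0\<close> and is positive for every later \<open>m\<close>. The arguments
  below 3 are read off from the recurrences, and for \<open>n \<le> k\<close> there are no partitions at all.\<close>

text \<open>The predicate \<open>D\<close> marks the values that may not be repeated. Keeping it arbitrary treats both
  parities at once and makes the family closed under lowering all parts, which replaces \<open>D\<close> by
  \<open>\<lambda>x. D (Suc x)\<close>.\<close>

definition distinct_partitions :: "(nat \<Rightarrow> bool) \<Rightarrow> nat \<Rightarrow> nat \<Rightarrow> nat list set" where
  "distinct_partitions D k n = {p. is_partition p \<and> perimeter p = n \<and> (\<forall>x\<in>set p. k < x) \<and>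
     (\<forall>x\<in>set p. D x \<longrightarrow> count_list p x = 1)}"

definition num_distinct :: "(nat \<Rightarrow> bool) \<Rightarrow> nat \<Rightarrow> nat \<Rightarrow> nat" where
  "num_distinct D k n = card (distinct_partitions D k n)"

lemma finite_distinct_partitions: "finite (distinct_partitions D k n)"
  by (rule finite_subset[OF _ finite_partitions_perimeter[of n]])
    (auto simp: distinct_partitions_def)

lemma Nil_notin_distinct_partitions: "[] \<notin> distinct_partitions D k n"
  by (simp add: distinct_partitions_def is_partition_def)

lemma partition_avoids_initial_segment:
  assumes "is_partition p"
  shows "set p \<inter> {1..k} = {} \<longleftrightarrow> (\<forall>x\<in>set p. k < x)"
  using assms unfolding is_partition_def by fastforce

lemma red_eq_num_distinct: "red {1..k} n = num_distinct even k n"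
  unfolding red_def num_distinct_def red_set_def distinct_partitions_def
  using partition_avoids_initial_segment by (metis (no_types, lifting))

lemma rod_eq_num_distinct: "rod {1..k} n = num_distinct odd k n"
  unfolding rod_def num_distinct_def rod_set_def distinct_partitions_def
  using partition_avoids_initial_segment by (metis (no_types, lifting))

lemma num_distinct_eq_0:
  assumes "n \<le> k"
  shows "num_distinct D k n = 0"
proof -
  have "k < perimeter p" if "is_partition p" "\<forall>x\<in>set p. k < x" for p
  proof -
    have "p \<noteq> []" using that by (simp add: is_partition_def)
    then have "k < Max (set p)" "0 < length p" using that by auto
    then show ?thesis unfolding perimeter_def by linarith
  qed
  then have "distinct_partitions D k n = {}"
    using assms unfolding distinct_partitions_def by fastforce
  then show ?thesis by (simp add: num_distinct_def)
qed

section \<open>Shifting all parts by one\<close>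

lemma perimeter_map_Suc:
  assumes "p \<noteq> []"
  shows "perimeter (map Suc p) = Suc (perimeter p)"
proof -
  have "Max (set (map Suc p)) = Suc (Max (set p))"
    using assms mono_Max_commute[of Suc "set p"] by (simp add: mono_def)
  moreover have "0 < length p" using assms by simp
  ultimately show ?thesis unfolding perimeter_def by simp
qed

lemma num_distinct_shift: "num_distinct D (Suc k) (Suc n) = num_distinct (\<lambda>x. D (Suc x)) k n"
proof -
  have count: "count_list (map Suc p) (Suc x) = count_list p x" for p x
    by (induction p) auto
  have "distinct_partitions D (Suc k) (Suc n)
      = map Suc ` distinct_partitions (\<lambda>x. D (Suc x)) k n" (is "?L = map Suc ` ?R")
  proof
    show "?L \<subseteq> map Suc ` ?R"
    proof
      fix p assume p: "p \<in> ?L"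
      have "map Suc (map (\<lambda>x. x - 1) p) = p"
        using p by (auto simp: distinct_partitions_def intro!: map_idI)
      then obtain q where q: "p = map Suc q" by metis
      then have "q \<in> ?R"
        using p by (auto simp: distinct_partitions_def is_partition_def perimeter_map_Suc
            sorted_wrt_map count)
      then show "p \<in> map Suc ` ?R" using q by blast
    qed
    show "map Suc ` ?R \<subseteq> ?L"
      by (auto simp: distinct_partitions_def is_partition_def perimeter_map_Suc
            sorted_wrt_map count)
  qed
  then show ?thesis
    by (simp add: num_distinct_def card_image inj_on_def)
qed

lemma num_distinct_parity_shift:
  "num_distinct even k (k + m) = num_distinct (if even k then even else odd) 0 m \<and>
   num_distinct odd k (k + m) = num_distinct (if even k then odd else even) 0 m"
  by (induction k) (simp_all add: num_distinct_shift)

section \<open>Removing a smallest admissible part\<close>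

lemma perimeter_snoc:
  assumes "q \<noteq> []" "\<forall>x\<in>set q. v \<le> x"
  shows "perimeter (q @ [v]) = Suc (perimeter q)"
proof -
  have "Max (set q) \<in> set q" using assms(1) by (intro Max_in) auto
  then have "v \<le> Max (set q)" using assms(2) by blast
  then have "Max (set (q @ [v])) = Max (set q)" using assms(1) by (simp add: max_absorb2)
  moreover have "0 < length q" using assms by simp
  ultimately show ?thesis unfolding perimeter_def by simp
qed

text \<open>If \<open>Suc k\<close> occurs among parts exceeding \<open>k\<close>, it occupies the last position. After its
  removal another copy may remain exactly when \<open>Suc k\<close> is not required to be distinct. The empty
  list arises from the singleton \<open>[Suc k]\<close>, whose perimeter is \<open>Suc k\<close>.\<close>

lemma distinct_partitions_peel:
  "distinct_partitions D k (Suc n) = distinct_partitions D (Suc k) (Suc n) \<union>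
     (\<lambda>q. q @ [Suc k]) `
       (distinct_partitions D (if D (Suc k) then Suc k else k) n \<union> (if n = k then {[]} else {}))"
  (is "?L = ?M \<union> ?f ` (?N \<union> ?E)")
proof
  have mem: "q @ [Suc k] \<in> ?L \<longleftrightarrow> q \<in> ?N" if "q \<noteq> []" for q
  proof (cases "\<forall>x\<in>set q. Suc k \<le> x")
    case True
    have "(\<forall>x\<in>set (q @ [Suc k]). D x \<longrightarrow> count_list (q @ [Suc k]) x = 1) \<longleftrightarrow>
        (\<forall>x\<in>set q. D x \<longrightarrow> count_list q x = 1) \<and> (D (Suc k) \<longrightarrow> Suc k \<notin> set q)"
      by (auto simp: count_list_0_iff)
    moreover have "(\<forall>x\<in>set q. Suc k < x) \<longleftrightarrow> Suc k \<notin> set q"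
      using True by (metis le_neq_implies_less less_irrefl)
    ultimately show ?thesis
      using True that perimeter_snoc[OF that True]
      by (auto simp: distinct_partitions_def is_partition_def sorted_wrt_append Suc_le_eq)
  next
    case False
    then show ?thesis
      by (auto simp: distinct_partitions_def Suc_le_eq split: if_splits)
  qed
  have single: "[Suc k] \<in> ?L \<longleftrightarrow> n = k"
    by (auto simp: distinct_partitions_def is_partition_def perimeter_def)
  show "?L \<subseteq> ?M \<union> ?f ` (?N \<union> ?E)"
  proof
    fix p assume p: "p \<in> ?L"
    show "p \<in> ?M \<union> ?f ` (?N \<union> ?E)"
    proof (cases "Suc k \<in> set p")
      case False
      then have "\<forall>x\<in>set p. Suc k < x"
        using p unfolding distinct_partitions_def by (metis (no_types, lifting) mem_Collect_eq Suc_lessI)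
      then show ?thesis using p by (simp add: distinct_partitions_def)
    next
      case True
      have "p \<noteq> []" using True by auto
      then obtain q v where qv: "p = q @ [v]" by (metis rev_exhaust)
      have "v \<le> Suc k" "k < v"
        using p True qv by (auto simp: distinct_partitions_def is_partition_def sorted_wrt_append)
      then have eq: "p = q @ [Suc k]" using qv by simp
      then have "q \<in> ?N \<union> ?E" using p mem[of q] single by (cases "q = []") auto
      then show ?thesis using eq by blast
    qed
  qed
  have "?M \<subseteq> ?L" by (auto simp: distinct_partitions_def)
  moreover have "?f q \<in> ?L" if "q \<in> ?N" for q
    using that mem[of q] Nil_notin_distinct_partitions by metis
  moreover have "?f q \<in> ?L" if "q \<in> ?E" for q
    using that single by (auto split: if_splits)
  ultimately show "?M \<union> ?f ` (?N \<union> ?E) \<subseteq> ?L" by blast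
qed

lemma num_distinct_peel:
  "num_distinct D k (Suc n) = num_distinct D (Suc k) (Suc n) +
     num_distinct D (if D (Suc k) then Suc k else k) n + (if n = k then 1 else 0)"
proof -
  let ?N = "distinct_partitions D (if D (Suc k) then Suc k else k) n"
  let ?E = "if n = k then {[]} else {} :: nat list set"
  have "card (?N \<union> ?E) = card ?N + (if n = k then 1 else 0)"
    by (simp add: finite_distinct_partitions Nil_notin_distinct_partitions)
  moreover have "inj_on (\<lambda>q. q @ [Suc k]) (?N \<union> ?E)" by (simp add: inj_on_def)
  moreover have "distinct_partitions D (Suc k) (Suc n) \<inter> (\<lambda>q. q @ [Suc k]) ` (?N \<union> ?E) = {}"
    by (auto simp: distinct_partitions_def)
  moreover have "finite (?N \<union> ?E)" by (simp add: finite_distinct_partitions)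
  ultimately show ?thesis
    unfolding num_distinct_def distinct_partitions_peel[of D k n]
    by (subst card_Un_disjoint) (auto simp: finite_distinct_partitions card_image)
qed

section \<open>Comparing the two recurrences\<close>

lemma num_distinct_even_Suc:
  "num_distinct even 0 (Suc n) =
     num_distinct even 0 n + num_distinct odd 0 n + (if n = 0 then 1 else 0)"
  using num_distinct_peel[of even 0 n] by (simp add: num_distinct_shift)

lemma num_distinct_odd_1: "num_distinct odd 0 (Suc 0) = 1"
  using num_distinct_peel[of odd 0 0] by (simp add: num_distinct_shift num_distinct_eq_0)

lemma num_distinct_odd_Suc_Suc:
  "num_distinct odd 0 (Suc (Suc n)) = num_distinct even 0 (Suc n) + num_distinct even 0 n"
  using num_distinct_peel[of odd 0 "Suc n"] by (simp add: num_distinct_shift)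

text \<open>Substituting one recurrence into the other cancels all terms but one, so that the difference
  of the two counts appears as a count again and its sign is evident.\<close>

lemma num_distinct_excess:
  "num_distinct even 0 (m + 3) = num_distinct odd 0 (m + 3) + num_distinct even 0 m"
  by (simp add: numeral_3_eq_3 num_distinct_even_Suc[of "Suc (Suc m)"] num_distinct_odd_Suc_Suc)

lemma num_distinct_even_pos: "0 < m \<Longrightarrow> 0 < num_distinct even 0 m"
proof (induction m)
  case (Suc m)
  then show ?case by (cases "m = 0") (simp_all add: num_distinct_even_Suc)
qed simp

lemma num_distinct_even_vs_odd:
  shows "m \<ge> 4 \<or> m = 2 \<Longrightarrow> num_distinct odd 0 m < num_distinct even 0 m"
    and "m \<le> 1 \<or> m = 3 \<Longrightarrow> num_distinct even 0 m = num_distinct odd 0 m"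
proof -
  have even_0: "num_distinct even 0 0 = 0" and odd_0: "num_distinct odd 0 0 = 0"
    by (simp_all add: num_distinct_eq_0)
  have even_1: "num_distinct even 0 1 = 1" and odd_1: "num_distinct odd 0 1 = 1"
    using num_distinct_even_Suc[of 0] num_distinct_odd_1 even_0 odd_0 by simp_all
  have even_2: "num_distinct even 0 2 = 2" and odd_2: "num_distinct odd 0 2 = 1"
    using num_distinct_even_Suc[of 1] num_distinct_odd_Suc_Suc[of 0] even_0 even_1 odd_1
    by (simp_all add: numeral_2_eq_2)
  show "num_distinct odd 0 m < num_distinct even 0 m" if m: "m \<ge> 4 \<or> m = 2"
  proof (cases "m = 2")
    case True
    then show ?thesis using even_2 odd_2 by simp
  next
    case False
    then have "m = (m - 3) + 3" "0 < m - 3" using m by auto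
    then show ?thesis using num_distinct_excess[of "m - 3"] num_distinct_even_pos[of "m - 3"] by simp
  qed
  show "num_distinct even 0 m = num_distinct odd 0 m" if m: "m \<le> 1 \<or> m = 3"
  proof -
    consider "m = 0" | "m = 1" | "m = 3" using m by linarith
    then show ?thesis
      by cases (use even_0 odd_0 even_1 odd_1 num_distinct_excess[of 0] in simp_all)
  qed
qed

theorem theorem1p5:
  fixes k n :: nat
  assumes "0 < n"
  shows "(n \<ge> k + 4 \<or> n = k + 2 \<longrightarrow>
            (even k \<longrightarrow> red {1..k} n > rod {1..k} n) \<and>
            (odd k \<longrightarrow> rod {1..k} n > red {1..k} n)) \<and>
         (n \<le> k + 1 \<or> n = k + 3 \<longrightarrow> red {1..k} n = rod {1..k} n)"
proof (cases "n \<le> k")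
  case True
  then show ?thesis
    unfolding red_eq_num_distinct rod_eq_num_distinct by (simp add: num_distinct_eq_0)
next
  case False
  define m where "m = n - k"
  have n: "n = k + m" using False by (simp add: m_def)
  show ?thesis
    unfolding n red_eq_num_distinct rod_eq_num_distinct
    using num_distinct_parity_shift[of k m] num_distinct_even_vs_odd[of m] by auto
qed

end
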